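(* Let $M$ and $N$ be nonempty closed bounded convex subsets of a Hilbert space $X$. Let $F:M\cup N\to M\cup N$ satisfy (1) $F(M)\subseteq N$ and $F(N)\subseteq M$; and (2) $\|Fw-Fz\|\le\|w-z\|$ for all $w\in M$, $z\in N$. Let $\epsilon\in(0,1/2)$ and $\eta_n,\delta_n\in(\epsilon,1-\epsilon)$ for $n=0,1,2,\dots$. If $F$ maps $M$ into a compact subset of $N$, then for any $w_0\in M$ the sequence defined by $$w_{n+1}=(1-\eta_n)w_n+\eta_nP_M\Big(F\big((1-\delta_n)w_n+\delta_nP_MFw_n\big)\Big),\qquad n=0,1,2,\dots,$$ converges (in norm) to some $w\in M_0$ such that $\|w-Fw\|=d(M,N)$, provided $d(w_n,M_0)\to0$.
   Context: For subsets $M,N$ of a Hilbert space $X$: $d(M,N)=\inf\{\|w-z\|: w\in M, z\in N\}$; $d(w,A)=\inf\{\|w-a\|:a\in A\}$; and $M_0=\{w\in M:\|w-z'\|=d(M,N)\text{ for some } z'\in N\}$. $P_M:X\to M$ denotes the metric (nearest point) projection onto the closed convex set $M$. The map $F$ is not assumed to be continuous. *)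

theory Defs
  imports "HOL-Analysis.Analysis"
begin

(* The library's closest_point is restricted to type class heine_borel, i.e. to finite
   dimension, hence this version. The nearest point exists and is unique whenever M is
   nonempty, closed and convex in a Hilbert space. *)
definition metric_proj :: "'a::real_inner set \<Rightarrow> 'a \<Rightarrow> 'a"
  where "metric_proj M x = (THE p. p \<in> M \<and> (\<forall>q\<in>M. norm (x - p) \<le> norm (x - q)))"

definition proximal_part :: "'a::real_inner set \<Rightarrow> 'a set \<Rightarrow> 'a set"
  where "proximal_part M N = {w \<in> M. \<exists>z\<in>N. norm (w - z) = setdist M N}"

end

theory Submission
  imports Defs
begin

text \<open>
  Write \<open>P\<close> for the metric projection onto \<open>M\<close>, \<open>T = P \<circ> F\<close>, and \<open>M\<^sub>0\<close> for the proximal part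
  of \<open>M\<close>. The sequence is an Ishikawa iteration of \<open>T\<close>, but \<open>T\<close> need not be nonexpansive on \<open>M\<close>,
  and distances from the iterates to a fixed point \<open>p\<close> of \<open>T\<close> in \<open>M\<^sub>0\<close> may increase. The way out is
  to measure distances from the partner of \<open>p\<close> in \<open>N\<close> instead.

  In a Hilbert space all pairs of points that realise the distance between \<open>M\<close> and \<open>N\<close> differ by
  one and the same vector \<open>v\<close>, so the partner of \<open>p\<close> is \<open>p + v\<close>. By convexity \<open>v\<close> separates the
  two sets, and this yields two inequalities: for \<open>z \<in> N\<close> and \<open>p \<in> M\<^sub>0\<close>, the point \<open>P z\<close> is at most
  as far from \<open>p + v\<close> as \<open>z\<close> is from \<open>p\<close> (\<open>metric_proj_dist_shift_le\<close>); and for \<open>m \<in> M\<close> the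
  squared distance from \<open>m\<close> to \<open>p + v\<close> exceeds that to \<open>p\<close> by at least \<open>v \<bullet> v\<close>
  (\<open>dist_shift_ge\<close>), with equality on \<open>M\<^sub>0\<close>. As \<open>F\<close> maps partners to partners, the first one turns
  the contraction hypothesis into
  \<open>norm (T x - (T p + v)) \<le> norm (x - (p + v))\<close> for all \<open>x \<in> M\<close> and \<open>p \<in> M\<^sub>0\<close>.

  On \<open>M\<^sub>0\<close> this says that \<open>T\<close> is nonexpansive, and because its range is relatively compact it has a
  fixed point \<open>p\<close> there (\<open>nonexpansive_compact_range_has_fixed_point\<close>). Then \<open>T\<close> never moves a
  point of \<open>M\<close> away from \<open>p + v\<close>, and the strict convexity of the norm gives
  \<open>w n - T (w n) \<longlonglongrightarrow> 0\<close> (\<open>ishikawa_fejer_and_residual\<close>). Compactness of the range yields a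
  cluster point \<open>x\<close> of \<open>w\<close>, which lies in \<open>M\<^sub>0\<close> because the distances to \<open>M\<^sub>0\<close> vanish, and
  \<open>T x = x\<close>. Finally the distances from \<open>w n\<close> to \<open>x + v\<close> decrease, and along a subsequence they
  tend to \<open>norm v\<close>; hence they all do, and the second inequality forces \<open>w \<longlonglongrightarrow> x\<close>.
\<close>

section \<open>Metric projections in Hilbert space\<close>

text \<open>
  By the parallelogram law two points that nearly realise the distance from \<open>x\<close> to \<open>C\<close> are close to
  each other, because their midpoint lies in \<open>C\<close> as well. A minimising sequence is therefore Cauchy,
  and completeness replaces the compactness used in finite dimension.
\<close>

lemma nearest_point_exists:
  fixes C :: "'a::{real_inner, complete_space} set"
  assumes "C \<noteq> {}" "closed C" "convex C"
  shows "\<exists>p\<in>C. \<forall>q\<in>C. norm (x - p) \<le> norm (x - q)"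
proof -
  define d where "d = infdist x C"
  have d0: "0 \<le> d"
    by (simp add: d_def infdist_nonneg)
  have dle: "d \<le> norm (x - q)" if "q \<in> C" for q
    using infdist_le[OF that, of x] by (simp add: d_def dist_norm)
  have "\<exists>p\<in>C. (norm (x - p))\<^sup>2 < d\<^sup>2 + inverse (real (Suc n))" for n
  proof -
    have "d < sqrt (d\<^sup>2 + inverse (real (Suc n)))"
      by (rule real_less_rsqrt) simp
    then obtain p where "p \<in> C" "norm (x - p) < sqrt (d\<^sup>2 + inverse (real (Suc n)))"
      using assms(1) cInf_lessD[of "dist x ` C"]
      by (auto simp: d_def infdist_def dist_norm)
    moreover from this(2) have "(norm (x - p))\<^sup>2 < (sqrt (d\<^sup>2 + inverse (real (Suc n))))\<^sup>2"
      by (intro power_strict_mono) auto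
    moreover have "(sqrt (d\<^sup>2 + inverse (real (Suc n))))\<^sup>2 = d\<^sup>2 + inverse (real (Suc n))"
      by (intro real_sqrt_pow2 add_nonneg_nonneg) auto
    ultimately show ?thesis by (intro bexI[of _ p]) simp_all
  qed
  then obtain p where p: "\<And>n. p n \<in> C"
    "\<And>n. (norm (x - p n))\<^sup>2 < d\<^sup>2 + inverse (real (Suc n))"
    by metis
  have close: "(norm (p m - p n))\<^sup>2
      \<le> 2 * inverse (real (Suc m)) + 2 * inverse (real (Suc n))" for m n
  proof -
    have "(1/2) *\<^sub>R p m + (1/2) *\<^sub>R p n \<in> C"
      using assms(3) p(1) by (intro convexD) auto
    then have "d\<^sup>2 \<le> (norm (x - ((1/2) *\<^sub>R p m + (1/2) *\<^sub>R p n)))\<^sup>2"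
      using dle d0 by (intro power_mono) auto
    moreover have "(norm (p m - p n))\<^sup>2 + 4 * (norm (x - ((1/2) *\<^sub>R p m + (1/2) *\<^sub>R p n)))\<^sup>2
        = 2 * (norm (x - p m))\<^sup>2 + 2 * (norm (x - p n))\<^sup>2"
      by (simp add: power2_norm_eq_inner algebra_simps inner_commute)
    ultimately show ?thesis using p(2)[of m] p(2)[of n] by linarith
  qed
  have "Cauchy p"
  proof (rule metric_CauchyI)
    fix e :: real assume "0 < e"
    then have "0 < e\<^sup>2 / 4" by simp
    then obtain k where k: "inverse (real (Suc k)) < e\<^sup>2 / 4"
      using reals_Archimedean by blast
    have "dist (p m) (p n) < e" if "k \<le> m" "k \<le> n" for m n
    proof -
      have "inverse (real (Suc m)) \<le> inverse (real (Suc k))"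
        "inverse (real (Suc n)) \<le> inverse (real (Suc k))"
        using that by (auto intro!: le_imp_inverse_le)
      then have "(norm (p m - p n))\<^sup>2 < e\<^sup>2"
        using close[of m n] k by linarith
      then show ?thesis
        using \<open>0 < e\<close> by (simp add: dist_norm power2_less_imp_less)
    qed
    then show "\<exists>k. \<forall>m\<ge>k. \<forall>n\<ge>k. dist (p m) (p n) < e" by blast
  qed
  then obtain l where l: "p \<longlonglongrightarrow> l"
    using Cauchy_convergent convergent_def by blast
  have "l \<in> C"
    using closed_sequentially[OF assms(2)] p(1) l by blast
  have "(\<lambda>n. (norm (x - p n))\<^sup>2) \<longlonglongrightarrow> (norm (x - l))\<^sup>2"
    by (intro tendsto_intros l)
  moreover have "(\<lambda>n. d\<^sup>2 + inverse (real (Suc n))) \<longlonglongrightarrow> d\<^sup>2 + 0"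
    by (intro tendsto_intros LIMSEQ_inverse_real_of_nat)
  ultimately have "(norm (x - l))\<^sup>2 \<le> d\<^sup>2 + 0"
    by (rule LIMSEQ_le) (use p(2) less_imp_le in blast)
  then have "norm (x - l) \<le> d"
    using d0 power2_le_imp_le by simp
  then show ?thesis
    using \<open>l \<in> C\<close> dle order_trans by blast
qed

lemma
  fixes C :: "'a::{real_inner, complete_space} set"
  assumes "C \<noteq> {}" "closed C" "convex C"
  shows metric_proj_in: "metric_proj C x \<in> C"
    and metric_proj_le: "q \<in> C \<Longrightarrow> norm (x - metric_proj C x) \<le> norm (x - q)"
proof -
  let ?near = "\<lambda>p. p \<in> C \<and> (\<forall>q\<in>C. norm (x - p) \<le> norm (x - q))"
  have "\<exists>!p. ?near p"
  proof (rule ex_ex1I)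
    show "\<exists>p. ?near p" using nearest_point_exists[OF assms] by blast
    show "p = q" if "?near p" "?near q" for p q
      using any_closest_point_unique[OF assms(3,2), of p q x] that by (simp add: dist_norm)
  qed
  from theI'[OF this] have "?near (metric_proj C x)"
    unfolding metric_proj_def .
  then show "metric_proj C x \<in> C"
    and "q \<in> C \<Longrightarrow> norm (x - metric_proj C x) \<le> norm (x - q)" by auto
qed

lemma metric_proj_inner_le:
  fixes C :: "'a::{real_inner, complete_space} set"
  assumes "closed C" "convex C" "q \<in> C"
  shows "(x - metric_proj C x) \<bullet> (q - metric_proj C x) \<le> 0"
proof -
  have "C \<noteq> {}" using assms(3) by blast
  note P = this assms(1,2)
  show ?thesis
    by (rule any_closest_point_dot[OF assms(2,1) metric_proj_in[OF P] assms(3)])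
      (simp add: dist_norm metric_proj_le[OF P])
qed

lemma metric_proj_eqI:
  fixes C :: "'a::{real_inner, complete_space} set"
  assumes "closed C" "convex C" "p \<in> C" "\<And>q. q \<in> C \<Longrightarrow> norm (x - p) \<le> norm (x - q)"
  shows "metric_proj C x = p"
proof -
  have "C \<noteq> {}" using assms(3) by blast
  note P = this assms(1,2)
  show ?thesis
    by (rule any_closest_point_unique[OF assms(2,1) metric_proj_in[OF P] assms(3), of x])
      (simp_all add: dist_norm assms(4) metric_proj_le[OF P])
qed

text \<open>
  Adding the obtuse angle conditions at the two projections bounds the squared distance of the
  projections by an inner product, to which the Cauchy-Schwarz inequality applies.
\<close>

lemma metric_proj_nonexpansive:
  fixes C :: "'a::{real_inner, complete_space} set"
  assumes "C \<noteq> {}" "closed C" "convex C"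
  shows "norm (metric_proj C x - metric_proj C y) \<le> norm (x - y)"
proof -
  let ?p = "metric_proj C x" and ?q = "metric_proj C y"
  have "(x - ?p) \<bullet> (?q - ?p) \<le> 0" "(y - ?q) \<bullet> (?p - ?q) \<le> 0"
    using metric_proj_inner_le[OF assms(2,3)] metric_proj_in[OF assms] by blast+
  then have "(?p - ?q) \<bullet> (?p - ?q) \<le> (x - y) \<bullet> (?p - ?q)"
    by (simp add: algebra_simps inner_commute)
  also have "\<dots> \<le> norm (x - y) * norm (?p - ?q)"
    by (rule norm_cauchy_schwarz)
  finally have "norm (?p - ?q) * norm (?p - ?q) \<le> norm (x - y) * norm (?p - ?q)"
    by (simp add: dot_square_norm power2_eq_square)
  then show ?thesis
    by (cases "?p = ?q") (auto simp: mult_le_cancel_right)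
qed

section \<open>The gap vector between two convex sets\<close>

text \<open>
  The gap vector \<open>v\<close> is given through one proximal pair \<open>(p0, p0 + v)\<close>; it does not depend on the
  choice of that pair, as \<open>gap_unique\<close> shows.
\<close>

locale proximal_gap =
  fixes M N :: "'a::{real_inner, complete_space} set" and v :: 'a and p0 :: 'a
  assumes closed_M: "closed M" and convex_M: "convex M"
    and closed_N: "closed N" and convex_N: "convex N"
    and p0_in: "p0 \<in> M" and p0_shift_in: "p0 + v \<in> N"
    and norm_gap: "norm v = setdist M N"
begin

lemma norm_gap_le: "m \<in> M \<Longrightarrow> z \<in> N \<Longrightarrow> norm v \<le> norm (z - m)"
  using setdist_le_dist[of m M z N] by (simp add: norm_gap dist_norm norm_minus_commute)

text \<open>
  The gap vector separates \<open>M\<close> from \<open>N\<close> by two parallel hyperplanes at distance \<open>norm v\<close>: each of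
  \<open>p0\<close> and \<open>p0 + v\<close> is the point of its set nearest to the other, so both sets satisfy an obtuse
  angle condition with respect to \<open>v\<close>.
\<close>

lemma gap_inner_ge:
  assumes "m \<in> M" "z \<in> N"
  shows "v \<bullet> v \<le> (z - m) \<bullet> v"
proof -
  have "(p0 - (p0 + v)) \<bullet> (z - (p0 + v)) \<le> 0"
    using norm_gap_le[OF p0_in]
    by (intro any_closest_point_dot[OF convex_N closed_N p0_shift_in assms(2)])
       (simp add: dist_norm norm_minus_commute)
  moreover have "((p0 + v) - p0) \<bullet> (m - p0) \<le> 0"
    using norm_gap_le[OF _ p0_shift_in]
    by (intro any_closest_point_dot[OF convex_M closed_M p0_in assms(1)])
       (simp add: dist_norm norm_minus_commute)
  ultimately show ?thesis
    by (simp add: algebra_simps inner_commute)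
qed

lemma gap_unique:
  assumes "m \<in> M" "z \<in> N" "norm (m - z) = setdist M N"
  shows "z = m + v"
proof -
  have "(norm (z - m))\<^sup>2 = (norm v)\<^sup>2"
    using assms(3) by (simp add: norm_gap norm_minus_commute)
  then have "(z - m) \<bullet> (z - m) = v \<bullet> v"
    by (simp add: power2_norm_eq_inner)
  then have "(z - m - v) \<bullet> (z - m - v) \<le> 0"
    using gap_inner_ge[OF assms(1,2)] by (simp add: algebra_simps inner_commute)
  then have "z - m - v = 0"
    using inner_gt_zero_iff[of "z - m - v"] by linarith
  then show ?thesis
    by (simp add: algebra_simps)
qed

lemma proximal_part_eq: "proximal_part M N = {x \<in> M. x + v \<in> N}"
proof (rule set_eqI, rule iffI)
  show "x \<in> {x \<in> M. x + v \<in> N}" if "x \<in> proximal_part M N" for x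
    using that gap_unique by (auto simp: proximal_part_def)
  show "x \<in> proximal_part M N" if "x \<in> {x \<in> M. x + v \<in> N}" for x
    using that by (auto simp: proximal_part_def norm_gap intro!: bexI[of _ "x + v"])
qed

lemma closed_proximal_part: "closed (proximal_part M N)"
proof -
  have "closed ((\<lambda>x. x + v) -` N)"
    by (intro closed_vimage closed_N continuous_intros)
  moreover have "proximal_part M N = M \<inter> (\<lambda>x. x + v) -` N"
    by (auto simp: proximal_part_eq)
  ultimately show ?thesis using closed_M by (simp add: closed_Int)
qed

lemma convex_proximal_part: "convex (proximal_part M N)"
proof (rule convexI)
  fix x y :: 'a and s t :: real
  assume *: "x \<in> proximal_part M N" "y \<in> proximal_part M N" "0 \<le> s" "0 \<le> t" "s + t = 1"
  have "s *\<^sub>R (x + v) + t *\<^sub>R (y + v) \<in> N"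
    using * by (intro convexD[OF convex_N]) (auto simp: proximal_part_eq)
  moreover have "s *\<^sub>R (x + v) + t *\<^sub>R (y + v) = s *\<^sub>R x + t *\<^sub>R y + (s + t) *\<^sub>R v"
    by (simp add: algebra_simps)
  moreover have "s *\<^sub>R x + t *\<^sub>R y \<in> M"
    using * by (intro convexD[OF convex_M]) (auto simp: proximal_part_eq)
  ultimately show "s *\<^sub>R x + t *\<^sub>R y \<in> proximal_part M N"
    using *(5) by (simp add: proximal_part_eq)
qed

lemma metric_proj_shift:
  assumes "p \<in> proximal_part M N"
  shows "metric_proj M (p + v) = p"
  using assms norm_gap_le[of _ "p + v"]
  by (intro metric_proj_eqI closed_M convex_M) (auto simp: proximal_part_eq)

text \<open>
  Seen from \<open>p\<close>, the set \<open>M\<close> lies in the half-space opposite to \<open>v\<close>, so the angle at \<open>p\<close> between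
  \<open>m\<close> and \<open>p + v\<close> is not acute. Convergence of the distances to \<open>p + v\<close> can thus be converted
  into convergence to \<open>p\<close>.
\<close>

lemma dist_shift_ge:
  assumes "m \<in> M" "p \<in> proximal_part M N"
  shows "(norm (m - p))\<^sup>2 + (norm v)\<^sup>2 \<le> (norm (m - (p + v)))\<^sup>2"
  using gap_inner_ge[of m "p + v"] assms
  by (simp add: proximal_part_eq power2_norm_eq_inner algebra_simps inner_commute)

text \<open>The differences of points of the proximal part are orthogonal to \<open>v\<close>.\<close>

lemma dist_shift_eq:
  assumes "x \<in> proximal_part M N" "p \<in> proximal_part M N"
  shows "(norm (x - (p + v)))\<^sup>2 = (norm (x - p))\<^sup>2 + (norm v)\<^sup>2"
  using gap_inner_ge[of x "p + v"] gap_inner_ge[of p "x + v"] assms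
  by (simp add: proximal_part_eq power2_norm_eq_inner algebra_simps inner_commute)

text \<open>
  Exchanging the sets on which the two points lie does not cost any distance. Nonexpansiveness of
  the projection would only compare \<open>metric_proj M z\<close> with \<open>p\<close>; the bound for the remote point
  \<open>p + v\<close> is what makes distances to \<open>p + v\<close> monotone along the iteration.
  With \<open>m = metric_proj M z\<close>, expanding the squares leaves \<open>(z - m) \<bullet> (z - m) - v \<bullet> v\<close> to be
  bounded below, and this is done by completing the square \<open>(z - m - v) \<bullet> (z - m - v)\<close>.
\<close>

lemma metric_proj_dist_shift_le:
  assumes "z \<in> N" "p \<in> proximal_part M N"
  shows "norm (metric_proj M z - (p + v)) \<le> norm (z - p)"
proof -
  define m where "m = metric_proj M z"
  have p: "p \<in> M" "p + v \<in> N" using assms(2) by (auto simp: proximal_part_eq)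
  have "m \<in> M" using p(1) metric_proj_in closed_M convex_M unfolding m_def by blast
  have obtuse: "(z - m) \<bullet> (p - m) \<le> 0"
    unfolding m_def by (rule metric_proj_inner_le[OF closed_M convex_M p(1)])
  have far: "v \<bullet> v \<le> (z - p) \<bullet> v"
    by (rule gap_inner_ge[OF p(1) assms(1)])
  have young: "0 \<le> (z - m - v) \<bullet> (z - m - v)"
    by simp
  have "(m - (p + v)) \<bullet> (m - (p + v)) \<le> (z - p) \<bullet> (z - p)"
    using obtuse far young by (simp add: algebra_simps inner_commute)
  then show ?thesis
    by (simp add: norm_le m_def)
qed

end

section \<open>Existence of a proximal pair\<close>

lemma compact_convergent_subsequence:
  fixes f :: "nat \<Rightarrow> 'a::metric_space"
  assumes "compact K" "\<forall>n. f n \<in> K"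
  obtains l r where "l \<in> K" "strict_mono r" "(\<lambda>n. f (r n)) \<longlonglongrightarrow> l"
proof -
  have "seq_compact K" using assms(1) by (rule compact_imp_seq_compact)
  from seq_compactE[OF this assms(2)] show thesis
    using that by (auto simp: o_def)
qed

text \<open>
  Apply \<open>F\<close> to a minimising sequence of pairs: the pairs \<open>(F (z n), F (x n))\<close> are again minimising,
  and their second components have a cluster point in \<open>K\<close>. Its projection onto \<open>M\<close> completes a
  proximal pair.
\<close>

lemma proximal_pair_exists:
  fixes M N :: "'a::{real_inner, complete_space} set"
  assumes M: "M \<noteq> {}" "closed M" "convex M" and "N \<noteq> {}"
    and K: "compact K" "K \<subseteq> N" "F ` M \<subseteq> K" and "F ` N \<subseteq> M"
    and F: "\<And>x z. x \<in> M \<Longrightarrow> z \<in> N \<Longrightarrow> norm (F x - F z) \<le> norm (x - z)"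
  shows "\<exists>p\<in>M. \<exists>z\<in>N. norm (p - z) = setdist M N"
proof -
  let ?d = "setdist M N"
  have "\<exists>x\<in>M. \<exists>z\<in>N. dist x z < ?d + inverse (real (Suc n))" for n
  proof -
    have "?d < ?d + inverse (real (Suc n))" by simp
    then obtain x z where "x \<in> M" "z \<in> N" "dist x z < ?d + inverse (real (Suc n))"
      using setdist_ltE M(1) \<open>N \<noteq> {}\<close> by blast
    then show ?thesis by blast
  qed
  then obtain x z where xz: "\<And>n. x n \<in> M" "\<And>n. z n \<in> N"
    "\<And>n. dist (x n) (z n) < ?d + inverse (real (Suc n))"
    by metis
  have "\<forall>n. F (x n) \<in> K" using K(3) xz(1) by blast
  with K(1) obtain k r where k: "k \<in> K" "strict_mono r" "(\<lambda>n. F (x (r n))) \<longlonglongrightarrow> k"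
    by (rule compact_convergent_subsequence[where f = "\<lambda>n. F (x n)"]) blast
  define p where "p = metric_proj M k"
  have "p \<in> M" unfolding p_def by (rule metric_proj_in[OF M])
  have le: "norm (k - p) \<le> norm (k - F (x (r n))) + (?d + inverse (real (Suc (r n))))" for n
  proof -
    have "norm (k - p) \<le> norm (k - F (z (r n)))"
      unfolding p_def using metric_proj_le[OF M] assms(8) xz(2) by blast
    also have "\<dots> \<le> norm (k - F (x (r n))) + norm (F (x (r n)) - F (z (r n)))"
      using norm_triangle_ineq[of "k - F (x (r n))" "F (x (r n)) - F (z (r n))"] by simp
    also have "norm (F (x (r n)) - F (z (r n))) \<le> ?d + inverse (real (Suc (r n)))"
      using F[OF xz(1,2)] xz(3) by (metis dist_norm less_imp_le order_trans)
    finally show ?thesis by simp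
  qed
  have "(\<lambda>n. inverse (real (Suc (r n)))) \<longlonglongrightarrow> 0"
    using LIMSEQ_subseq_LIMSEQ[OF LIMSEQ_inverse_real_of_nat k(2)] by (simp add: o_def)
  with k(3) have "(\<lambda>n. norm (k - F (x (r n))) + (?d + inverse (real (Suc (r n)))))
      \<longlonglongrightarrow> norm (k - k) + (?d + 0)"
    by (intro tendsto_intros)
  then have "norm (k - p) \<le> norm (k - k) + (?d + 0)"
    by (rule LIMSEQ_le_const) (use le in blast)
  moreover have "?d \<le> norm (p - k)"
    using setdist_le_dist[of p M k N] \<open>p \<in> M\<close> k(1) K(2) by (auto simp: dist_norm)
  ultimately have "norm (p - k) = ?d" by (simp add: norm_minus_commute)
  then show ?thesis using \<open>p \<in> M\<close> k(1) K(2) by blast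
qed

section \<open>Fixed points of nonexpansive maps\<close>

text \<open>
  The averages \<open>(1 - c) *\<^sub>R T x + c *\<^sub>R a\<close> are strict contractions, and their fixed points \<open>x\<close>
  satisfy \<open>x - T x = c *\<^sub>R (a - T x)\<close>. As \<open>c\<close> tends to \<open>0\<close> these are approximate fixed points of \<open>T\<close>,
  and any cluster point of their images is a fixed point.
\<close>

lemma nonexpansive_compact_range_has_fixed_point:
  fixes T :: "'a::{real_normed_vector, complete_space} \<Rightarrow> 'a"
  assumes C: "C \<noteq> {}" "closed C" "convex C" and "T ` C \<subseteq> C"
    and K: "compact K" "T ` C \<subseteq> K"
    and T: "\<And>x y. x \<in> C \<Longrightarrow> y \<in> C \<Longrightarrow> norm (T x - T y) \<le> norm (x - y)"
  shows "\<exists>p\<in>C. T p = p"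
proof -
  obtain a where "a \<in> C" using C(1) by blast
  have "\<exists>x\<in>C. x - T x = inverse (real (Suc n)) *\<^sub>R (a - T x)" for n
  proof -
    define c where "c = inverse (real (Suc n))"
    have c: "0 < c" "c \<le> 1" by (auto simp: c_def field_simps)
    let ?f = "\<lambda>x. (1 - c) *\<^sub>R T x + c *\<^sub>R a"
    have "\<exists>!x\<in>C. ?f x = x"
    proof (rule Banach_fix[where c = "1 - c"])
      show "complete C" using C(2) by (simp add: complete_eq_closed)
      show "?f ` C \<subseteq> C"
        using assms(4) \<open>a \<in> C\<close> c by (auto intro!: convexD[OF C(3)])
      show "dist (?f x) (?f y) \<le> (1 - c) * dist x y" if "x \<in> C" "y \<in> C" for x y
      proof -
        have "dist (?f x) (?f y) = norm ((1 - c) *\<^sub>R (T x - T y))"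
          by (simp add: dist_norm scaleR_diff_right)
        also have "\<dots> = (1 - c) * norm (T x - T y)" using c by simp
        also have "\<dots> \<le> (1 - c) * dist x y"
          using T[OF that] c by (simp add: dist_norm mult_left_mono)
        finally show ?thesis .
      qed
    qed (use C c in auto)
    then obtain x where "x \<in> C" "?f x = x" by blast
    then have "x - T x = c *\<^sub>R (a - T x)"
      by (simp add: algebra_simps)
    with \<open>x \<in> C\<close> show ?thesis unfolding c_def by blast
  qed
  then obtain x where x: "\<And>n. x n \<in> C"
    "\<And>n. x n - T (x n) = inverse (real (Suc n)) *\<^sub>R (a - T (x n))"
    by metis
  have "\<forall>n. T (x n) \<in> K" using K(2) x(1) by blast
  with K(1) obtain l r where l: "l \<in> K" "strict_mono r" and Tl: "(\<lambda>n. T (x (r n))) \<longlonglongrightarrow> l"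
    by (rule compact_convergent_subsequence[where f = "\<lambda>n. T (x n)"]) blast
  have inv0: "(\<lambda>n. inverse (real (Suc (r n)))) \<longlonglongrightarrow> 0"
    using LIMSEQ_subseq_LIMSEQ[OF LIMSEQ_inverse_real_of_nat l(2)] by (simp add: o_def)
  have "(\<lambda>n. T (x (r n)) + inverse (real (Suc (r n))) *\<^sub>R (a - T (x (r n))))
      \<longlonglongrightarrow> l + 0 *\<^sub>R (a - l)"
    by (intro tendsto_intros Tl inv0)
  moreover have "T (x (r n)) + inverse (real (Suc (r n))) *\<^sub>R (a - T (x (r n))) = x (r n)" for n
    unfolding x(2)[symmetric] by simp
  ultimately have xl: "(\<lambda>n. x (r n)) \<longlonglongrightarrow> l" by simp
  have "l \<in> C" using closed_sequentially[OF C(2) _ xl] x(1) by blast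
  have "(\<lambda>n. norm (x (r n) - l)) \<longlonglongrightarrow> 0"
    using xl by (simp add: LIM_zero tendsto_norm_zero)
  then have "(\<lambda>n. T (x (r n)) - T l) \<longlonglongrightarrow> 0"
    by (rule Lim_null_comparison[rotated]) (simp add: T x(1) \<open>l \<in> C\<close>)
  then have "(\<lambda>n. T (x (r n))) \<longlonglongrightarrow> T l" by (simp add: LIM_zero_cancel)
  then have "T l = l" using Tl LIMSEQ_unique by blast
  with \<open>l \<in> C\<close> show ?thesis by blast
qed

section \<open>Ishikawa iterations\<close>

lemma norm_convex_combination_sq:
  fixes x y :: "'a::real_inner"
  shows "(norm ((1 - t) *\<^sub>R x + t *\<^sub>R y))\<^sup>2
    = (1 - t) * (norm x)\<^sup>2 + t * (norm y)\<^sup>2 - t * (1 - t) * (norm (x - y))\<^sup>2"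
  unfolding power2_norm_eq_inner
  by (simp add: inner_simps inner_commute) algebra

text \<open>
  Each of the two averagings gains a term from uniform convexity. The gain of the inner one is
  already a multiple of the residual \<open>norm (x - T x)\<close>; that of the outer one is discarded, and
  its weight \<open>s \<ge> e\<close> together with \<open>t \<ge> e\<close> and \<open>1 - t \<ge> e\<close> accounts for the factor \<open>e ^ 3\<close>.
  The centre \<open>q\<close> may lie outside \<open>C\<close>: it will be a point of the other set.
\<close>

lemma ishikawa_step:
  fixes T :: "'a::real_inner \<Rightarrow> 'a"
  assumes "convex C" "T ` C \<subseteq> C" and q: "\<And>x. x \<in> C \<Longrightarrow> norm (T x - q) \<le> norm (x - q)"
    and "x \<in> C" "0 \<le> e" and s: "e \<le> s" "s \<le> 1 - e" and t: "e \<le> t" "t \<le> 1 - e"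
  defines "u \<equiv> (1 - t) *\<^sub>R x + t *\<^sub>R T x"
  shows "(norm ((1 - s) *\<^sub>R x + s *\<^sub>R T u - q))\<^sup>2 + e ^ 3 * (norm (x - T x))\<^sup>2 \<le> (norm (x - q))\<^sup>2"
proof -
  have shift: "(1 - t) *\<^sub>R x + t *\<^sub>R y - q = (1 - t) *\<^sub>R (x - q) + t *\<^sub>R (y - q)" for t y
    by (simp add: algebra_simps)
  have expand: "(norm ((1 - t) *\<^sub>R x + t *\<^sub>R y - q))\<^sup>2
      = (1 - t) * (norm (x - q))\<^sup>2 + t * (norm (y - q))\<^sup>2 - t * (1 - t) * (norm (x - y))\<^sup>2" for t y
    unfolding shift norm_convex_combination_sq by simp
  have "T x \<in> C" using assms(2,4) by blast
  then have "u \<in> C"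
    unfolding u_def using assms by (intro convexD) auto
  have sq: "(norm (T y - q))\<^sup>2 \<le> (norm (y - q))\<^sup>2" if "y \<in> C" for y
    using q[OF that] by (intro power_mono) auto
  have "t * (norm (T x - q))\<^sup>2 \<le> t * (norm (x - q))\<^sup>2"
    using sq[OF assms(4)] t \<open>0 \<le> e\<close> by (intro mult_left_mono) auto
  then have u: "(norm (u - q))\<^sup>2 \<le> (norm (x - q))\<^sup>2 - t * (1 - t) * (norm (x - T x))\<^sup>2"
    unfolding u_def expand by (simp add: algebra_simps)
  have "(norm ((1 - s) *\<^sub>R x + s *\<^sub>R T u - q))\<^sup>2
      \<le> (1 - s) * (norm (x - q))\<^sup>2 + s * (norm (T u - q))\<^sup>2"
    unfolding expand using s \<open>0 \<le> e\<close> by simp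
  also have "\<dots> \<le> (1 - s) * (norm (x - q))\<^sup>2
      + s * ((norm (x - q))\<^sup>2 - t * (1 - t) * (norm (x - T x))\<^sup>2)"
    using order_trans[OF sq[OF \<open>u \<in> C\<close>] u] s \<open>0 \<le> e\<close>
    by (intro add_left_mono mult_left_mono) simp_all
  also have "\<dots> = (norm (x - q))\<^sup>2 - s * (t * (1 - t)) * (norm (x - T x))\<^sup>2"
    by (simp add: algebra_simps)
  finally have "(norm ((1 - s) *\<^sub>R x + s *\<^sub>R T u - q))\<^sup>2
      + s * (t * (1 - t)) * (norm (x - T x))\<^sup>2 \<le> (norm (x - q))\<^sup>2" by simp
  moreover have "e * (e * e) \<le> s * (t * (1 - t))"
    using s t \<open>0 \<le> e\<close> by (intro mult_mono) auto
  then have "e ^ 3 * (norm (x - T x))\<^sup>2 \<le> s * (t * (1 - t)) * (norm (x - T x))\<^sup>2"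
    by (intro mult_right_mono) (auto simp: power3_eq_cube mult.assoc)
  ultimately show ?thesis by linarith
qed

lemma ishikawa_in:
  assumes "convex C" "T ` C \<subseteq> C" and "w 0 \<in> C"
    and "\<And>n. 0 \<le> \<eta> n" "\<And>n. \<eta> n \<le> 1" "\<And>n. 0 \<le> \<delta> n" "\<And>n. \<delta> n \<le> 1"
    and rec: "\<And>n. w (Suc n) = (1 - \<eta> n) *\<^sub>R w n
           + \<eta> n *\<^sub>R T ((1 - \<delta> n) *\<^sub>R w n + \<delta> n *\<^sub>R T (w n))"
  shows "w n \<in> C"
proof (induction n)
  case (Suc n)
  have "T (w n) \<in> C" using assms(2) Suc by blast
  then have "(1 - \<delta> n) *\<^sub>R w n + \<delta> n *\<^sub>R T (w n) \<in> C"
    using assms Suc by (intro convexD) auto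
  then have "T ((1 - \<delta> n) *\<^sub>R w n + \<delta> n *\<^sub>R T (w n)) \<in> C"
    using assms(2) by blast
  then show ?case
    unfolding rec using assms Suc by (intro convexD) auto
qed (rule assms(3))

text \<open>
  By \<open>ishikawa_step\<close> the squared residuals are bounded by the decrements of a convergent sequence.
\<close>

lemma ishikawa_fejer_and_residual:
  fixes T :: "'a::real_inner \<Rightarrow> 'a"
  assumes "convex C" "T ` C \<subseteq> C" and q: "\<And>x. x \<in> C \<Longrightarrow> norm (T x - q) \<le> norm (x - q)"
    and w: "\<And>n. w n \<in> C" and "0 < e"
    and "\<And>n. e \<le> \<eta> n" "\<And>n. \<eta> n \<le> 1 - e" "\<And>n. e \<le> \<delta> n" "\<And>n. \<delta> n \<le> 1 - e"
    and rec: "\<And>n. w (Suc n) = (1 - \<eta> n) *\<^sub>R w n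
           + \<eta> n *\<^sub>R T ((1 - \<delta> n) *\<^sub>R w n + \<delta> n *\<^sub>R T (w n))"
  shows "decseq (\<lambda>n. norm (w n - q))" and "(\<lambda>n. w n - T (w n)) \<longlonglongrightarrow> 0"
proof -
  let ?a = "\<lambda>n. (norm (w n - q))\<^sup>2"
  have step: "?a (Suc n) + e ^ 3 * (norm (w n - T (w n)))\<^sup>2 \<le> ?a n" for n
    unfolding rec using assms by (intro ishikawa_step[where C = C]) auto
  then have dec: "?a (Suc n) \<le> ?a n" for n
    using step[of n] \<open>0 < e\<close> by (smt (verit) mult_nonneg_nonneg zero_le_power zero_le_power2)
  show "decseq (\<lambda>n. norm (w n - q))"
    by (rule decseq_SucI, rule power2_le_imp_le[OF dec norm_ge_zero])
  have "decseq ?a" using dec by (rule decseq_SucI)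
  then obtain L where L: "?a \<longlonglongrightarrow> L"
    using decseq_convergent[of ?a 0] by auto
  have "(\<lambda>n. (?a n - ?a (Suc n)) / e ^ 3) \<longlonglongrightarrow> (L - L) / e ^ 3"
    using \<open>0 < e\<close> by (intro tendsto_intros L LIMSEQ_Suc) auto
  then have "(\<lambda>n. (?a n - ?a (Suc n)) / e ^ 3) \<longlonglongrightarrow> 0" by simp
  then have "(\<lambda>n. (norm (w n - T (w n)))\<^sup>2) \<longlonglongrightarrow> 0"
  proof (rule Lim_null_comparison[rotated])
    show "\<forall>\<^sub>F n in sequentially. norm ((norm (w n - T (w n)))\<^sup>2) \<le> (?a n - ?a (Suc n)) / e ^ 3"
    proof (rule always_eventually, rule allI)
      fix n
      show "norm ((norm (w n - T (w n)))\<^sup>2) \<le> (?a n - ?a (Suc n)) / e ^ 3"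
        using step[of n] \<open>0 < e\<close> by (simp add: pos_le_divide_eq mult.commute)
    qed
  qed
  then have "(\<lambda>n. sqrt ((norm (w n - T (w n)))\<^sup>2)) \<longlonglongrightarrow> sqrt 0"
    by (rule tendsto_real_sqrt)
  then show "(\<lambda>n. w n - T (w n)) \<longlonglongrightarrow> 0"
    by (simp add: tendsto_norm_zero_iff)
qed

section \<open>Convergence to a best proximity point\<close>

theorem corollary2p4:
  fixes M N :: "'a::{real_inner, complete_space} set"
    and F :: "'a \<Rightarrow> 'a"
    and \<epsilon> :: real
    and \<eta> \<delta> :: "nat \<Rightarrow> real"
    and w :: "nat \<Rightarrow> 'a"
  assumes "M \<noteq> {}" and "closed M" and "bounded M" and "convex M"
    and "N \<noteq> {}" and "closed N" and "bounded N" and "convex N"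
    and "F ` M \<subseteq> N" and "F ` N \<subseteq> M"
    and "\<And>x z. x \<in> M \<Longrightarrow> z \<in> N \<Longrightarrow> norm (F x - F z) \<le> norm (x - z)"
    and "\<epsilon> \<in> {0<..<1/2}"
    and "\<And>n. \<eta> n \<in> {\<epsilon><..<1 - \<epsilon>}"
    and "\<And>n. \<delta> n \<in> {\<epsilon><..<1 - \<epsilon>}"
    and "\<exists>K. compact K \<and> K \<subseteq> N \<and> F ` M \<subseteq> K"
    and "w 0 \<in> M"
    and "\<And>n. w (Suc n) = (1 - \<eta> n) *\<^sub>R w n
           + \<eta> n *\<^sub>R metric_proj M (F ((1 - \<delta> n) *\<^sub>R w n + \<delta> n *\<^sub>R metric_proj M (F (w n))))"
    and "(\<lambda>n. infdist (w n) (proximal_part M N)) \<longlonglongrightarrow> 0"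
  shows "\<exists>x \<in> proximal_part M N. w \<longlonglongrightarrow> x \<and> norm (x - F x) = setdist M N"
proof -
  note M = assms(1,2,4) and F = assms(11)
  obtain K where K: "compact K" "K \<subseteq> N" "F ` M \<subseteq> K" using assms(15) by blast
  obtain p0 z0 where p0: "p0 \<in> M" "z0 \<in> N" "norm (p0 - z0) = setdist M N"
    using proximal_pair_exists[OF M assms(5) K assms(10) F] by blast
  define v where "v = z0 - p0"
  interpret proximal_gap M N v p0
    using p0 assms(2,4,6,8) by unfold_locales (auto simp: v_def norm_minus_commute)
  define M0 where "M0 = proximal_part M N"
  have M0: "p \<in> M0 \<longleftrightarrow> p \<in> M \<and> p + v \<in> N" for p
    by (simp add: M0_def proximal_part_eq)
  have "M0 \<noteq> {}" using p0_in p0_shift_in M0 by blast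
  define T where "T = (\<lambda>x. metric_proj M (F x))"
  have TM: "T ` M \<subseteq> M" unfolding T_def using metric_proj_in[OF M] by blast

  (* F maps the proximal pair (p, p + v) to a pair at distance at most norm v, hence to a
     proximal pair with its components exchanged. *)
  have shadow: "F p = F (p + v) + v" "F (p + v) \<in> M0" if "p \<in> M0" for p
  proof -
    have in_sets: "F (p + v) \<in> M" "F p \<in> N"
      using that assms(9,10) M0 by blast+
    have "norm (F p - F (p + v)) \<le> norm v"
      using F[of p "p + v"] that M0 by simp
    then have "norm (F (p + v) - F p) = setdist M N"
      using norm_gap_le[OF in_sets] norm_gap by (simp add: norm_minus_commute)
    from gap_unique[OF in_sets this] show "F p = F (p + v) + v" .
    then show "F (p + v) \<in> M0" using in_sets M0 by metis
  qed
  have T_eq: "T p = F (p + v)" if "p \<in> M0" for p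
    unfolding T_def shadow(1)[OF that]
    using metric_proj_shift shadow(2)[OF that] M0_def by blast
  have T_shift: "norm (T x - (T p + v)) \<le> norm (x - (p + v))" if "x \<in> M" "p \<in> M0" for x p
  proof -
    have "norm (T x - (T p + v)) \<le> norm (F x - T p)"
      unfolding T_def[THEN fun_cong, of x]
      using metric_proj_dist_shift_le that shadow(2) T_eq assms(9) M0_def by auto
    also have "\<dots> \<le> norm (x - (p + v))"
      using F[of x "p + v"] that T_eq M0 by simp
    finally show ?thesis .
  qed

  have TM0: "T ` M0 \<subseteq> M0" using T_eq shadow(2) by auto
  have T_M0: "norm (T x - T p) \<le> norm (x - p)" if "x \<in> M0" "p \<in> M0" for x p
  proof -
    have "(norm (T x - (T p + v)))\<^sup>2 \<le> (norm (x - (p + v)))\<^sup>2"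
      using T_shift[of x p] that M0 by (intro power_mono) auto
    then have "(norm (T x - T p))\<^sup>2 \<le> (norm (x - p))\<^sup>2"
      using dist_shift_eq that TM0 unfolding M0_def by (auto simp: image_subset_iff)
    then show ?thesis by (rule power2_le_imp_le) simp
  qed
  have "continuous_on K (metric_proj M)"
  proof (rule continuous_on_subset[OF _ subset_UNIV], rule lipschitz_on_continuous_on)
    show "1-lipschitz_on UNIV (metric_proj M)"
      using metric_proj_nonexpansive[OF M] by (intro lipschitz_onI) (auto simp: dist_norm)
  qed
  then have compact_range: "compact (metric_proj M ` K)"
    using K(1) by (rule compact_continuous_image)
  have T_range: "T ` M \<subseteq> metric_proj M ` K" using K(3) by (auto simp: T_def)
  have "T ` M0 \<subseteq> metric_proj M ` K" using T_range M0 by blast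
  then obtain p where p: "p \<in> M0" "T p = p"
    using nonexpansive_compact_range_has_fixed_point
      [OF \<open>M0 \<noteq> {}\<close> closed_proximal_part[folded M0_def]
        convex_proximal_part[folded M0_def] TM0 compact_range _ T_M0]
    by blast

  have \<epsilon>: "0 < \<epsilon>" and steps: "\<epsilon> \<le> \<eta> n" "\<eta> n \<le> 1 - \<epsilon>" "\<epsilon> \<le> \<delta> n" "\<delta> n \<le> 1 - \<epsilon>" for n
    using assms(12) assms(13,14)[of n] by auto
  have unit: "0 \<le> \<eta> n" "\<eta> n \<le> 1" "0 \<le> \<delta> n" "\<delta> n \<le> 1" for n
    using steps[of n] \<epsilon> by auto
  have rec: "w (Suc n) = (1 - \<eta> n) *\<^sub>R w n
           + \<eta> n *\<^sub>R T ((1 - \<delta> n) *\<^sub>R w n + \<delta> n *\<^sub>R T (w n))" for n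
    by (simp add: T_def assms(17))
  have wM: "w n \<in> M" for n
    by (rule ishikawa_in[where w = w and T = T and \<eta> = \<eta> and \<delta> = \<delta>, OF assms(4) TM assms(16) unit rec])
  have fejer: "norm (T y - (x + v)) \<le> norm (y - (x + v))" if "x \<in> M0" "T x = x" "y \<in> M" for x y
    using T_shift[OF that(3,1)] that(2) by simp
  have residual: "(\<lambda>n. w n - T (w n)) \<longlonglongrightarrow> 0"
    by (rule ishikawa_fejer_and_residual(2)[where w = w and T = T and \<eta> = \<eta> and \<delta> = \<delta>, OF
        assms(4) TM fejer[OF p] wM \<epsilon> steps rec])

  have "\<forall>n. T (w n) \<in> metric_proj M ` K" using T_range wM by blast
  with compact_range obtain x r where r: "strict_mono r" and Twx: "(\<lambda>n. T (w (r n))) \<longlonglongrightarrow> x"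
    by (rule compact_convergent_subsequence[where f = "\<lambda>n. T (w n)"]) blast
  have "(\<lambda>n. w (r n) - T (w (r n))) \<longlonglongrightarrow> 0"
    using LIMSEQ_subseq_LIMSEQ[OF residual r] by (simp add: o_def)
  from tendsto_add[OF this Twx] have wx: "(\<lambda>n. w (r n)) \<longlonglongrightarrow> x" by simp
  have "(\<lambda>n. infdist (w (r n)) M0) \<longlonglongrightarrow> infdist x M0"
    by (intro tendsto_infdist wx)
  moreover have "(\<lambda>n. infdist (w (r n)) M0) \<longlonglongrightarrow> 0"
    using LIMSEQ_subseq_LIMSEQ[OF assms(18) r] by (simp add: o_def M0_def)
  ultimately have "infdist x M0 = 0" by (rule LIMSEQ_unique)
  then have xM0: "x \<in> M0"
    using in_closed_iff_infdist_zero closed_proximal_part \<open>M0 \<noteq> {}\<close> M0_def by blast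

  (* Stated for arbitrary sequences because it is used twice: for T (w (r n)), to identify the
     cluster point x as a fixed point, and for w itself. *)
  have near: "a \<longlonglongrightarrow> y" if "\<And>n. a n \<in> M" "y \<in> M0" "\<And>n. norm (a n - (y + v)) \<le> b n" "b \<longlonglongrightarrow> norm v"
    for a b y
  proof -
    have "(\<lambda>n. (b n)\<^sup>2 - (norm v)\<^sup>2) \<longlonglongrightarrow> (norm v)\<^sup>2 - (norm v)\<^sup>2"
      by (intro tendsto_intros that(4))
    then have "(\<lambda>n. (b n)\<^sup>2 - (norm v)\<^sup>2) \<longlonglongrightarrow> 0" by simp
    then have "(\<lambda>n. (norm (a n - y))\<^sup>2) \<longlonglongrightarrow> 0"
    proof (rule Lim_null_comparison[rotated], intro always_eventually allI)
      fix n
      have "(norm (a n - (y + v)))\<^sup>2 \<le> (b n)\<^sup>2"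
        using that(3) by (intro power_mono) auto
      then show "norm ((norm (a n - y))\<^sup>2) \<le> (b n)\<^sup>2 - (norm v)\<^sup>2"
        using dist_shift_ge[OF that(1)[of n]] that(2) M0_def by fastforce
    qed
    then have "(\<lambda>n. sqrt ((norm (a n - y))\<^sup>2)) \<longlonglongrightarrow> sqrt 0"
      by (rule tendsto_real_sqrt)
    then show ?thesis by (simp add: tendsto_norm_zero_iff LIM_zero_cancel)
  qed
  have sub_dist: "(\<lambda>n. norm (w (r n) - (x + v))) \<longlonglongrightarrow> norm v"
  proof -
    have "(\<lambda>n. norm (w (r n) - (x + v))) \<longlonglongrightarrow> norm (x - (x + v))"
      by (intro tendsto_intros wx)
    then show ?thesis by simp
  qed
  (* T need not be continuous, but at points of M0 the shifted inequality replaces continuity. *)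
  have "T x \<in> M0" using TM0 xM0 by blast
  have "(\<lambda>n. T (w (r n))) \<longlonglongrightarrow> T x"
    by (rule near[OF _ \<open>T x \<in> M0\<close> T_shift[OF wM xM0] sub_dist]) (use TM wM in blast)
  then have Tx: "T x = x" using Twx LIMSEQ_unique by blast

  have dec: "decseq (\<lambda>n. norm (w n - (x + v)))"
    by (rule ishikawa_fejer_and_residual(1)[where w = w and T = T and \<eta> = \<eta> and \<delta> = \<delta>, OF
        assms(4) TM fejer[OF xM0 Tx] wM \<epsilon> steps rec])
  then obtain L where L: "(\<lambda>n. norm (w n - (x + v))) \<longlonglongrightarrow> L"
    using decseq_convergent[OF dec, of 0] by auto
  have "(\<lambda>n. norm (w (r n) - (x + v))) \<longlonglongrightarrow> L"
    using LIMSEQ_subseq_LIMSEQ[OF L r] by (simp add: o_def)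
  then have "L = norm v" using sub_dist LIMSEQ_unique by blast
  then have "w \<longlonglongrightarrow> x" using near[OF wM xM0 order_refl, of id] L by simp
  moreover have "norm (x - F x) = setdist M N"
    using shadow(1)[OF xM0] T_eq[OF xM0] Tx norm_gap by (metis add_diff_cancel_left' norm_minus_commute)
  ultimately show ?thesis using xM0 M0_def by blast
qed

end
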